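(* Neither the coverage measure $I_C$ nor the directed coverage measure $I_{DC}$ is $\varepsilon$-split proof.
   Context: For $x,y\in\mathbb{R}^d$, $y$ dominates $x$ if $x_i\le y_i$ for all $i\in[d]$ and $x_j<y_j$ for some $j\in[d]$. A set of alternatives is a finite set $A\subseteq\mathbb{R}^d$ ($d\ge 1$ arbitrary) none of whose elements is dominated by another element of $A$. Let $\|x-y\|=\sum_{i=1}^d|x_i-y_i|$ and $\|x-y\|_+=\sum_{i=1}^d\max(x_i-y_i,0)$. For a finite set $B\subseteq\mathbb{R}^d$ and nonempty $S\subseteq B$, $I_C(S,B)=\max_{a\in B}\min_{s\in S}\|a-s\|$ and $I_{DC}(S,B)=\max_{a\in B}\min_{s\in S}\|a-s\|_+$ (lower is better for both). For a positive integer $k$, $\mathcal{S}(I,B,k)$ is the set of all $S\subseteq B$ with $|S|=k$ minimizing $I(S,B)$ among the size-$k$ subsets of $B$. A measure $I$ is $\varepsilon$-split proof if for any set of alternatives $A$ and any $k\in\mathbb{N}$ with $1\le k\le|A|$ there exists some $\varepsilon>0$ such that for all $x\in A$ and all $y_\varepsilon,z_\varepsilon\in\mathbb{R}^d$ with $\|x-y_\varepsilon\|<\varepsilon$ and $\|x-z_\varepsilon\|<\varepsilon$ the following holds: if $S_\varepsilon\in\mathcal{S}(I,(A\setminus\{x\})\cup\{y_\varepsilon,z_\varepsilon\},k)$, then (i) $S_\varepsilon\subseteq A$ and $S_\varepsilon\in\mathcal{S}(I,A,k)$, or (ii) $(S_\varepsilon\setminus\{y_\varepsilon,z_\varepsilon\})\cup\{x\}\in\mathcal{S}(I,A,k)$.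 *)

theory Defs
  imports "Jordan_Normal_Form.Matrix"
begin

text \<open>
  The notion of split proofness quantifies over all dimensions \<open>d\<close>, so points of \<open>\<real>\<^sup>d\<close> are elements
  of \<^term>\<open>carrier_vec d :: real vec set\<close>, with coordinates indexed by \<open>0, \<dots>, d - 1\<close>.
\<close>

definition dominates :: "real vec \<Rightarrow> real vec \<Rightarrow> bool" where
  "dominates y x \<longleftrightarrow> dim_vec x = dim_vec y \<and>
     (\<forall>i<dim_vec x. x $ i \<le> y $ i) \<and> (\<exists>j<dim_vec x. x $ j < y $ j)"

definition set_of_alternatives :: "nat \<Rightarrow> real vec set \<Rightarrow> bool" where
  "set_of_alternatives d A \<longleftrightarrow>
     finite A \<and> A \<subseteq> carrier_vec d \<and> (\<forall>x\<in>A. \<forall>y\<in>A. \<not> dominates y x)"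

definition l1_norm :: "real vec \<Rightarrow> real" where
  "l1_norm v = (\<Sum>i<dim_vec v. \<bar>v $ i\<bar>)"

definition l1_norm_pos :: "real vec \<Rightarrow> real" where
  "l1_norm_pos v = (\<Sum>i<dim_vec v. max (v $ i) 0)"

text \<open>
  A measure maps a chosen subset \<open>S\<close> and a ground set \<open>B\<close> to a real. The two measures below are
  meaningful for finite \<open>B\<close> and nonempty \<open>S \<subseteq> B\<close>, and are only evaluated there in what follows.
\<close>

type_synonym measure_fun = "real vec set \<Rightarrow> real vec set \<Rightarrow> real"

definition coverage :: measure_fun where
  "coverage S B = Max ((\<lambda>a. Min ((\<lambda>s. l1_norm (a - s)) ` S)) ` B)"

definition directed_coverage :: measure_fun where
  "directed_coverage S B = Max ((\<lambda>a. Min ((\<lambda>s. l1_norm_pos (a - s)) ` S)) ` B)"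

definition optimal_sets :: "measure_fun \<Rightarrow> real vec set \<Rightarrow> nat \<Rightarrow> real vec set set" where
  "optimal_sets I B k = {S. is_arg_min (\<lambda>S. I S B) (\<lambda>S. S \<subseteq> B \<and> card S = k) S}"

definition eps_split_proof :: "measure_fun \<Rightarrow> bool" where
  "eps_split_proof I \<longleftrightarrow>
     (\<forall>d A k. 1 \<le> d \<longrightarrow> set_of_alternatives d A \<longrightarrow> 1 \<le> k \<longrightarrow> k \<le> card A \<longrightarrow>
       (\<exists>\<epsilon>>0. \<forall>x\<in>A. \<forall>y\<in>carrier_vec d. \<forall>z\<in>carrier_vec d.
          l1_norm (x - y) < \<epsilon> \<longrightarrow> l1_norm (x - z) < \<epsilon> \<longrightarrow>
          (\<forall>S\<in>optimal_sets I ((A - {x}) \<union> {y, z}) k.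
             (S \<subseteq> A \<and> S \<in> optimal_sets I A k) \<or>
             (S - {y, z}) \<union> {x} \<in> optimal_sets I A k)))"

end

theory Submission
  imports Defs
begin

text \<open>
  Take three equally spaced points \<open>a, x, b\<close> on the antidiagonal of the plane and \<open>k = 2\<close>. One point
  already attains the optimal value here, by choosing the middle point \<open>x\<close>. Splitting \<open>x\<close> into a
  point \<open>y\<close> slightly towards \<open>a\<close> and a point \<open>z\<close> slightly towards \<open>b\<close> makes \<open>{y, z}\<close> optimal, but
  merging \<open>y\<close> and \<open>z\<close> back into \<open>x\<close> leaves a set with only one element. On the antidiagonal both
  distances are multiples of the usual distance of the line, so the same example works for both
  measures.
\<close>

definition antidiag :: "real \<Rightarrow> real vec" where
  "antidiag t = vec 2 (\<lambda>i. if i = 0 then t else - t)"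

lemma antidiag_carrier [simp]: "antidiag t \<in> carrier_vec 2"
  by (simp add: antidiag_def)

lemma antidiag_diff [simp]: "antidiag s - antidiag t = antidiag (s - t)"
  by (rule eq_vecI) (auto simp: antidiag_def)

lemma antidiag_eq_iff [simp]: "antidiag s = antidiag t \<longleftrightarrow> s = t"
proof
  assume "antidiag s = antidiag t"
  then have "antidiag s $ 0 = antidiag t $ 0" by simp
  then show "s = t" by (simp add: antidiag_def)
qed simp

text \<open>Moving along this line raises one coordinate by exactly what the other loses.\<close>

lemma not_dominates_antidiag: "\<not> dominates (antidiag s) (antidiag t)"
  by (auto simp: dominates_def antidiag_def less_2_cases_iff)

lemma l1_norm_antidiag: "l1_norm (antidiag t) = 2 * \<bar>t\<bar>"
  by (simp add: l1_norm_def antidiag_def numeral_2_eq_2)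

text \<open>At most one of the entries \<open>t\<close> and \<open>- t\<close> is positive, so the
  positive part loses direction and is half of the full norm.\<close>

lemma l1_norm_pos_antidiag: "l1_norm_pos (antidiag t) = \<bar>t\<bar>"
  by (simp add: l1_norm_pos_def antidiag_def numeral_2_eq_2)

lemma set_of_alternatives_antidiag:
  "finite T \<Longrightarrow> set_of_alternatives 2 (antidiag ` T)"
  by (auto simp: set_of_alternatives_def not_dominates_antidiag)

lemma Max_Min_le:
  fixes f :: "'a \<Rightarrow> 'b \<Rightarrow> real"
  assumes "finite B" "B \<noteq> {}" "finite S" "\<And>a. a \<in> B \<Longrightarrow> \<exists>s\<in>S. f a s \<le> r"
  shows "Max ((\<lambda>a. Min (f a ` S)) ` B) \<le> r"
proof -
  have "Min (f a ` S) \<le> r" if "a \<in> B" for a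
  proof -
    from assms(4)[OF that] obtain s where "s \<in> S" "f a s \<le> r" by blast
    then show ?thesis using assms(3) by (meson Min_le finite_imageI imageI order_trans)
  qed
  then show ?thesis using assms(1,2) by simp
qed

lemma le_Max_Min:
  fixes f :: "'a \<Rightarrow> 'b \<Rightarrow> real"
  assumes "finite B" "a \<in> B" "finite S" "S \<noteq> {}" "\<And>s. s \<in> S \<Longrightarrow> r \<le> f a s"
  shows "r \<le> Max ((\<lambda>a. Min (f a ` S)) ` B)"
proof -
  have "r \<le> Min (f a ` S)" using assms(3-5) by simp
  also have "\<dots> \<le> Max ((\<lambda>a. Min (f a ` S)) ` B)" using assms(1,2) by simp
  finally show ?thesis .
qed

text \<open>Leaving out an outer point costs at least \<open>c * (1 - e)\<close>, and taking both
  outer points costs the same at the inner ones. The factor \<open>c\<close> is 2 for coverage and 1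
  for directed coverage.\<close>

lemma split_pair_optimal:
  fixes N :: "real vec \<Rightarrow> real"
  assumes N: "\<And>t. N (antidiag t) = c * \<bar>t\<bar>" and c: "0 < c" and e: "0 < e" "e \<le> 1 / 3"
  shows "{antidiag (- e), antidiag e} \<in>
    optimal_sets (\<lambda>S B. Max ((\<lambda>a. Min ((\<lambda>s. N (a - s)) ` S)) ` B))
      (antidiag ` {- 1, - e, e, 1}) 2"
    (is "?S0 \<in> optimal_sets ?I ?B 2")
proof -
  \<comment> \<open>Each inner point covers itself and the outer point on its side.\<close>
  have upper: "?I ?S0 ?B \<le> c * (1 - e)"
    by (rule Max_Min_le) (use c e in \<open>auto simp: N\<close>)
  have lower: "c * (1 - e) \<le> ?I S ?B" if S: "S \<subseteq> ?B" "card S = 2" for S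
  proof -
    have fin: "finite S" "S \<noteq> {}" using S(2) by (auto intro: card_ge_0_finite)
    consider "antidiag (- 1) \<notin> S" | "antidiag 1 \<notin> S" | "{antidiag (- 1), antidiag 1} \<subseteq> S"
      by blast
    then show ?thesis
    proof cases
      case 1
      \<comment> \<open>The point nearest to the omitted one is
        \<open>antidiag (- e)\<close>.\<close>
      show ?thesis
        by (rule le_Max_Min[where a = "antidiag (- 1)"])
          (use 1 S fin c e in \<open>auto simp: N\<close>)
    next
      case 2
      show ?thesis
        by (rule le_Max_Min[where a = "antidiag 1"])
          (use 2 S fin c e in \<open>auto simp: N\<close>)
    next
      case 3
      then have eq: "S = {antidiag (- 1), antidiag 1}"
        using S(2) fin(1) card_subset_eq[of S "{antidiag (- 1), antidiag 1}"] by simp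
      \<comment> \<open>The inner point at \<open>e\<close> is uncovered; the outer point at 1 is
        closest to it.\<close>
      show ?thesis
        by (rule le_Max_Min[where a = "antidiag e"])
          (use eq c e in \<open>auto simp: N\<close>)
    qed
  qed
  have "?S0 \<subseteq> ?B" "card ?S0 = 2" using e by auto
  moreover have "\<not> ?I S ?B < ?I ?S0 ?B" if "S \<subseteq> ?B" "card S = 2" for S
    using upper lower[OF that] by linarith
  ultimately show ?thesis
    unfolding optimal_sets_def is_arg_min_def by blast
qed

text \<open>\<open>N\<close> enters only through the measure; the closeness of the split points to
  \<open>x\<close> is always in \<open>l1_norm\<close>.\<close>

lemma not_eps_split_proof_if_antidiag:
  fixes N :: "real vec \<Rightarrow> real"
  assumes N: "\<And>t. N (antidiag t) = c * \<bar>t\<bar>" and c: "0 < c"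
  shows "\<not> eps_split_proof (\<lambda>S B. Max ((\<lambda>a. Min ((\<lambda>s. N (a - s)) ` S)) ` B))"
    (is "\<not> eps_split_proof ?I")
proof
  let ?A = "antidiag ` {- 1, 0, 1}"
  assume "eps_split_proof ?I"
  moreover have "card ?A = 3"
    by (subst card_image) (auto simp: inj_on_def)
  moreover have "set_of_alternatives 2 ?A"
    by (rule set_of_alternatives_antidiag) simp
  ultimately obtain \<epsilon> where \<epsilon>: "\<epsilon> > 0" and
    split: "\<forall>x\<in>?A. \<forall>y\<in>carrier_vec 2. \<forall>z\<in>carrier_vec 2.
      l1_norm (x - y) < \<epsilon> \<longrightarrow> l1_norm (x - z) < \<epsilon> \<longrightarrow>
      (\<forall>S\<in>optimal_sets ?I ((?A - {x}) \<union> {y, z}) 2.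
        (S \<subseteq> ?A \<and> S \<in> optimal_sets ?I ?A 2) \<or>
        (S - {y, z}) \<union> {x} \<in> optimal_sets ?I ?A 2)"
    unfolding eps_split_proof_def by (elim allE[of _ 2] allE[of _ ?A]) auto
  \<comment> \<open>In \<open>l1_norm\<close> the split points are at distance \<open>2 * e\<close>
    from the middle, hence a third of \<epsilon>. The bound 1/3 keeps them strictly between the
    outer points.\<close>
  define e where "e = min (1 / 3) (\<epsilon> / 3)"
  have e: "0 < e" "e \<le> 1 / 3" "2 * e < \<epsilon>"
    using \<epsilon> by (auto simp: e_def)
  let ?x = "antidiag 0" and ?y = "antidiag (- e)" and ?z = "antidiag e"
  have "(?A - {?x}) \<union> {?y, ?z} = antidiag ` {- 1, - e, e, 1}"
    by auto
  then have opt: "{?y, ?z} \<in> optimal_sets ?I ((?A - {?x}) \<union> {?y, ?z}) 2"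
    using split_pair_optimal[OF N c e(1,2)] by simp
  have "?x \<in> ?A" "l1_norm (?x - ?y) < \<epsilon>" "l1_norm (?x - ?z) < \<epsilon>"
    using e by (auto simp: l1_norm_antidiag)
  with split opt have
    "{?y, ?z} \<subseteq> ?A \<or> ({?y, ?z} - {?y, ?z}) \<union> {?x} \<in> optimal_sets ?I ?A 2"
    using antidiag_carrier by blast
  moreover have "\<not> {?y, ?z} \<subseteq> ?A"
    using e by auto
  \<comment> \<open>Failure by cardinality alone: a singleton is no candidate of size 2.\<close>
  moreover have "({?y, ?z} - {?y, ?z}) \<union> {?x} \<notin> optimal_sets ?I ?A 2"
    by (simp add: optimal_sets_def is_arg_min_def)
  ultimately show False by blast
qed

theorem proposition16:
  "\<not> eps_split_proof coverage \<and> \<not> eps_split_proof directed_coverage"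
proof
  have "coverage = (\<lambda>S B. Max ((\<lambda>a. Min ((\<lambda>s. l1_norm (a - s)) ` S)) ` B))"
    by (intro ext) (rule coverage_def)
  then show "\<not> eps_split_proof coverage"
    using not_eps_split_proof_if_antidiag[OF l1_norm_antidiag] by simp
next
  have "directed_coverage = (\<lambda>S B. Max ((\<lambda>a. Min ((\<lambda>s. l1_norm_pos (a - s)) ` S)) ` B))"
    by (intro ext) (rule directed_coverage_def)
  then show "\<not> eps_split_proof directed_coverage"
    using not_eps_split_proof_if_antidiag[of l1_norm_pos 1] by (simp add: l1_norm_pos_antidiag)
qed

end
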